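(* Let $A \in \mathbb{R}^{n \times n}$ be symmetric and positive semi-definite, with rows $A_1,\dots,A_n$, let $i \in \{1,\dots,n\}$ be an index with $A_{ii} \neq 0$, and let $$B = A - \frac{A_i^{T} A_i}{A_{ii}}.$$ Then $$ \left\| B \right\|_F^2 \leq \|A\|_F^2 - \frac{\|A_i\|_{\ell^2}^4}{A_{ii}^2}.$$ In particular, $$ \left\| B \right\|_F^2 \leq \|A\|_F^2 - A_{ii}^2.$$
   Context: $A_i$ denotes the $i$-th row of $A$, viewed as a $1\times n$ row vector, so that $A_i^T A_i$ is an $n \times n$ rank-one matrix with entries $(A_i^TA_i)_{jk} = A_{ij}A_{ik}$. $\|A_i\|_{\ell^2}$ is the Euclidean norm of that row and $\|\cdot\|_F$ is the Frobenius norm. Passing from $A$ to $B$ is what is meant by "removing the $i$-th row/column" (one step of partial Cholesky with pivot $i$). *)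

theory Defs
  imports "HOL-Analysis.Analysis"
begin

text \<open>Positive semi-definiteness of the quadratic form; symmetry is not part of this definition.\<close>

definition pos_semidef :: "real ^ 'n ^ 'n \<Rightarrow> bool"
  where "pos_semidef A \<longleftrightarrow> (\<forall>x. 0 \<le> x \<bullet> (A *v x))"

text \<open>
  A matrix is a vector of row vectors, and \<^const>\<open>norm\<close> on \<^typ>\<open>real ^ 'n ^ 'm\<close> is the
  Euclidean norm of the vector of Euclidean norms of the rows, i.e. the Frobenius norm (not an
  operator norm).
\<close>

lemma norm_matrix_eq_frobenius:
  fixes A :: "real ^ 'n ^ 'm"
  shows "norm A = sqrt (\<Sum>j\<in>UNIV. \<Sum>k\<in>UNIV. (A $ j $ k)\<^sup>2)"
  by (simp add: norm_vec_def L2_set_def sum_nonneg)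

lemma rowvector_gram_nth:
  fixes A :: "real ^ 'n ^ 'm"
  shows "(transpose (rowvector (row i A) :: real ^ 'n ^ 1) ** (rowvector (row i A) :: real ^ 'n ^ 1)) $ j $ k
    = A $ i $ j * A $ i $ k"
  by (simp add: matrix_matrix_mult_def transpose_def rowvector_def row_def)

end

theory Submission
  imports Defs
begin

text \<open>
  Write \<open>v\<close> for the pivot row, \<open>d = A $ i $ i\<close> and \<open>C = v v\<^sup>T / d\<close>, so that \<open>A = B + C\<close>.
  In the Frobenius inner product, which is the inner product of \<^typ>\<open>real ^ 'n ^ 'n\<close>,
  \<open>\<parallel>A\<parallel>\<^sup>2 = \<parallel>B\<parallel>\<^sup>2 + \<parallel>C\<parallel>\<^sup>2 + 2 (B \<bullet> C)\<close>.
  The rank-one term has norm \<open>\<parallel>C\<parallel> = \<parallel>v\<parallel>\<^sup>2 / d\<close>, and the cross term equals \<open>(v \<bullet> B v) / d\<close>.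
  The latter is nonnegative since \<open>d > 0\<close> and since \<open>B\<close>, which is the Schur complement of the
  pivot padded with a zero row and column, is again positive semi-definite
  (\<open>pos_semidef_pivot_step\<close>). Dropping the cross term gives the first bound. The second one
  follows because \<open>d\<close> is an entry of \<open>v\<close>, so that \<open>\<parallel>v\<parallel>\<^sup>2 / d \<ge> d\<close>.
\<close>

definition outer_square :: "real ^ 'n \<Rightarrow> real ^ 'n ^ 'n"
  where "outer_square v = (\<chi> j k. v $ j * v $ k)"

lemma outer_square_nth: "outer_square v $ j = v $ j *\<^sub>R v"
  by (simp add: outer_square_def vec_eq_iff)

lemma transpose_rowvector_mult_rowvector_row:
  fixes A :: "real ^ 'n ^ 'm"
  shows "transpose (rowvector (row i A) :: real ^ 'n ^ 1) ** (rowvector (row i A) :: real ^ 'n ^ 1)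
    = outer_square (A $ i)"
  by (simp only: vec_eq_iff rowvector_gram_nth) (simp add: outer_square_def)

lemma outer_square_mult_vec: "outer_square v *v x = (v \<bullet> x) *\<^sub>R v"
  by (simp add: vec_eq_iff matrix_vector_mul_component outer_square_nth)

text \<open>This is the Frobenius pairing identity \<open>tr (M\<^sup>T v v\<^sup>T) = v\<^sup>T M\<^sup>T v = v \<bullet> M v\<close>.\<close>

lemma inner_outer_square: "M \<bullet> outer_square v = v \<bullet> (M *v v)"
  by (simp add: inner_vec_def[of M] inner_vec_def[of v "M *v v"] outer_square_nth
      matrix_vector_mul_component)

lemma norm_outer_square: "norm (outer_square v) = (norm v)\<^sup>2"
proof -
  have "(norm (outer_square v))\<^sup>2 = ((norm v)\<^sup>2)\<^sup>2"
    by (simp add: power2_norm_eq_inner inner_outer_square outer_square_mult_vec)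
      (simp add: power2_eq_square)
  then show ?thesis
    by (rule power2_eq_imp_eq) simp_all
qed

lemma pos_semidef_diagonal_nonneg:
  assumes "pos_semidef A"
  shows "0 \<le> A $ i $ i"
proof -
  have "axis i 1 \<bullet> (A *v axis i 1) = A $ i $ i"
    by (simp add: inner_axis' matrix_vector_mul_component inner_axis)
  then show ?thesis
    using assms unfolding pos_semidef_def by metis
qed

text \<open>
  Completing the square in the pivot coordinate: the new quadratic form at \<open>x\<close> is the minimum of
  the old one over the line through \<open>x\<close> in direction \<open>e\<^sub>i\<close>, and a minimum of nonnegative values is
  nonnegative.
\<close>

lemma pos_semidef_pivot_step:
  fixes A :: "real ^ 'n ^ 'n"
  assumes sym: "transpose A = A" and psd: "pos_semidef A" and pivot: "A $ i $ i \<noteq> 0"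
  shows "pos_semidef (A - (1 / A $ i $ i) *\<^sub>R outer_square (A $ i))"
  unfolding pos_semidef_def
proof
  fix x
  let ?e = "axis i 1 :: real ^ 'n" and ?d = "A $ i $ i" and ?s = "A $ i \<bullet> x"
  \<comment> \<open>The step length at which the quadratic form is minimal along the line.\<close>
  define t where "t = ?s / ?d"
  have e_A: "?e \<bullet> (A *v y) = A $ i \<bullet> y" for y
    by (simp add: inner_axis' matrix_vector_mul_component)
  have A_e: "y \<bullet> (A *v ?e) = A $ i \<bullet> y" for y
    by (metis dot_lmul_matrix e_A inner_commute sym transpose_matrix_vector)
  have "0 \<le> (x - t *\<^sub>R ?e) \<bullet> (A *v (x - t *\<^sub>R ?e))"
    using psd by (simp add: pos_semidef_def)
  also have "\<dots> = x \<bullet> (A *v x) - t * ?s - t * ?s + t * t * ?d"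
    by (simp add: matrix_vector_mult_diff_distrib matrix_vector_mult_scaleR inner_diff_left
        inner_diff_right e_A A_e inner_axis algebra_simps)
  also have "\<dots> = x \<bullet> (A *v x) - ?s * ?s / ?d"
    using pivot by (simp add: t_def)
  also have "\<dots> = x \<bullet> ((A - (1 / ?d) *\<^sub>R outer_square (A $ i)) *v x)"
    by (simp add: matrix_vector_mult_diff_rdistrib scaleR_matrix_vector_assoc[symmetric]
        outer_square_mult_vec inner_diff_right inner_commute)
  finally show "0 \<le> x \<bullet> ((A - (1 / ?d) *\<^sub>R outer_square (A $ i)) *v x)" .
qed

theorem corollary1:
  fixes A B :: "real ^ 'n ^ 'n" and i :: 'n
  assumes "transpose A = A"
    and "pos_semidef A"
    and "A $ i $ i \<noteq> 0"
    and "B = A - (1 / A $ i $ i) *\<^sub>R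
          (transpose (rowvector (row i A) :: real ^ 'n ^ 1) ** (rowvector (row i A) :: real ^ 'n ^ 1))"
  shows "(norm B)\<^sup>2 \<le> (norm A)\<^sup>2 - norm (row i A) ^ 4 / (A $ i $ i)\<^sup>2
    \<and> (norm B)\<^sup>2 \<le> (norm A)\<^sup>2 - (A $ i $ i)\<^sup>2"
proof -
  let ?d = "A $ i $ i" and ?v = "A $ i"
  define C where "C = (1 / ?d) *\<^sub>R outer_square ?v"
  have d_pos: "0 < ?d"
    using pos_semidef_diagonal_nonneg[OF assms(2), of i] assms(3) by simp
  have B_eq: "B = A - C"
    unfolding assms(4) transpose_rowvector_mult_rowvector_row C_def ..
  have "pos_semidef B"
    unfolding B_eq C_def using assms(1-3) by (rule pos_semidef_pivot_step)
  then have "0 \<le> ?v \<bullet> (B *v ?v)"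
    by (simp add: pos_semidef_def)
  then have cross: "0 \<le> B \<bullet> C"
    using d_pos by (simp add: C_def inner_outer_square)
  have norm_C: "norm C = (norm ?v)\<^sup>2 / ?d"
    using d_pos by (simp add: C_def norm_outer_square)
  have "(norm A)\<^sup>2 = (norm (B + C))\<^sup>2"
    by (simp add: B_eq)
  also have "\<dots> = (norm B)\<^sup>2 + (norm C)\<^sup>2 + 2 * (B \<bullet> C)"
    by (simp add: power2_norm_eq_inner inner_add_left inner_add_right inner_commute)
  finally have bound: "(norm B)\<^sup>2 \<le> (norm A)\<^sup>2 - (norm C)\<^sup>2"
    using cross by simp
  have "?d\<^sup>2 \<le> (norm ?v)\<^sup>2"
    using component_le_norm_cart[of ?v i] d_pos by (simp add: power_mono)
  then have "?d \<le> norm C"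
    using d_pos by (simp add: norm_C pos_le_divide_eq power2_eq_square)
  then have "?d\<^sup>2 \<le> (norm C)\<^sup>2"
    using d_pos by (simp add: power_mono)
  moreover have "row i A = ?v"
    by (simp add: row_def)
  then have "(norm C)\<^sup>2 = norm (row i A) ^ 4 / ?d\<^sup>2"
    by (simp add: norm_C power_divide flip: power_mult)
  ultimately show ?thesis
    using bound by simp
qed

end
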